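(* Let $X$ and $Y$ be metric spaces and let $f\colon X\to Y$ be a continuous function. Then the big Lipschitz derivative $\operatorname{Lip} f\colon X\to[0,+\infty]$ is an $\mathcal{F}_\sigma$-upper semicontinuous function.
   Context: The metric on a metric space $X$ is written $|\cdot-\cdot|_X$. For a function $f\colon X\to Y$ between metric spaces and $x\in X$, the big Lipschitz derivative is $\operatorname{Lip} f(x)=\limsup_{u\to x}\frac{1}{|u-x|_X}|f(u)-f(x)|_Y=\inf_{r>0}\sup\{\frac{|f(u)-f(x)|_Y}{|u-x|_X}: u\in X,\ 0<|u-x|_X<r\}\in[0,+\infty]$, with the convention $\sup\varnothing=0$ (so $\operatorname{Lip} f(x)=0$ at isolated points $x$). Let $\mathcal{F}_\sigma$ denote the family of all $F_\sigma$-subsets of $X$ (countable unions of closed sets). A function $g\colon X\to\overline{\mathbb{R}}=[-\infty,+\infty]$ is $\mathcal{F}_\sigma$-upper semicontinuous if $g^{-1}([-\infty,\gamma))\in\mathcal{F}_\sigma$ for every $\gamma\in\mathbb{R}$. *)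

theory Defs
  imports "HOL-Analysis.Analysis"
begin

text \<open>
  Valued in \<^typ>\<open>ennreal\<close>, whose least element is 0: the supremum of the empty set is 0,
  so the derivative vanishes at isolated points.
\<close>

definition big_Lip :: "'a metric \<Rightarrow> 'b metric \<Rightarrow> ('a \<Rightarrow> 'b) \<Rightarrow> 'a \<Rightarrow> ennreal" where
  "big_Lip X Y f x =
    (INF r\<in>{r::real. 0 < r}.
      SUP u\<in>{u \<in> mspace X. 0 < mdist X u x \<and> mdist X u x < r}.
        ennreal (mdist Y (f u) (f x) / mdist X u x))"

definition fsigma_upper_semicontinuous :: "'a topology \<Rightarrow> ('a \<Rightarrow> ereal) \<Rightarrow> bool" where
  "fsigma_upper_semicontinuous T g \<longleftrightarrow>
    (\<forall>\<gamma>::real. fsigma_in T {x \<in> topspace T. g x < ereal \<gamma>})"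

end

theory Submission
  imports Defs
begin

text \<open>
  For fixed \<open>r\<close> and \<open>q\<close>, the condition \<open>|f(u) - f(x)| \<le> q|u - x|\<close> for all \<open>u\<close> with
  \<open>|u - x| < r\<close> defines a closed set of points \<open>x\<close>: it is an intersection over \<open>u\<close> of sets,
  each the union of two closed ones. The inequality \<open>Lip f(x) < \<gamma>\<close> says that \<open>x\<close> lies in one of
  these sets for some rational \<open>r > 0\<close> and \<open>0 \<le> q < \<gamma>\<close>, which leaves a countable union.
\<close>

definition lipschitz_points :: "'a metric \<Rightarrow> 'b metric \<Rightarrow> ('a \<Rightarrow> 'b) \<Rightarrow> real \<Rightarrow> real \<Rightarrow> 'a set" where
  "lipschitz_points X Y f r q =
    {x \<in> mspace X. \<forall>u\<in>mspace X. mdist X u x < r \<longrightarrow> mdist Y (f u) (f x) \<le> q * mdist X u x}"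

lemma closedin_le_continuous_map:
  fixes g h :: "'a \<Rightarrow> real"
  assumes "continuous_map T euclideanreal g" "continuous_map T euclideanreal h"
  shows "closedin T {x \<in> topspace T. g x \<le> h x}"
proof -
  have "closedin T {x \<in> topspace T. g x - h x \<in> {..0}}"
    using assms by (intro closedin_continuous_map_preimage[where Y = euclideanreal] continuous_map_diff) auto
  then show ?thesis
    by simp
qed

lemma closedin_lipschitz_points:
  assumes f: "continuous_map (mtopology_of X) (mtopology_of Y) f"
  shows "closedin (mtopology_of X) (lipschitz_points X Y f r q)"
proof -
  let ?T = "mtopology_of X"
  \<comment> \<open>The implication for a fixed \<open>u\<close> becomes a disjunction. Because its
    premise is the strict bound \<open>mdist X u x < r\<close>, the negated premise is a weak
    inequality between continuous functions of \<open>x\<close>, hence closed.\<close>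
  define B where "B u = {x \<in> topspace ?T. r \<le> mdist X u x} \<union>
    {x \<in> topspace ?T. mdist Y (f u) (f x) \<le> q * mdist X u x}" for u
  have "closedin ?T (B u)" if u: "u \<in> mspace X" for u
  proof -
    have "f u \<in> mspace Y"
      using continuous_map_image_subset_topspace[OF f] u by auto
    then have "continuous_map ?T euclideanreal (\<lambda>x. mdist Y (f u) (f x))"
      using f by (intro continuous_map_mdist) auto
    moreover have "continuous_map ?T euclideanreal (\<lambda>x. mdist X u x)"
      using u by (intro continuous_map_mdist) auto
    ultimately show ?thesis
      unfolding B_def
      by (intro closedin_Un closedin_le_continuous_map continuous_map_real_mult_left) auto
  qed
  \<comment> \<open>Inserting the whole space keeps the family nonempty when \<open>mspace X\<close>
    is empty and confines the intersection to the space.\<close>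
  then have "closedin ?T (\<Inter> (insert (topspace ?T) (B ` mspace X)))"
    by (intro closedin_Inter) (auto simp del: topspace_mtopology_of)
  also have "\<Inter> (insert (topspace ?T) (B ` mspace X)) = lipschitz_points X Y f r q"
    by (force simp: B_def lipschitz_points_def not_less)
  finally show ?thesis .
qed

text \<open>Strictness leaves room for a rational \<open>q\<close> between the supremum over some
  punctured ball and \<open>c\<close>, and shrinking the radius to a rational preserves the bound.
  Conversely, a bound \<open>q < c\<close> on one ball bounds the infimum over all radii.\<close>

lemma big_Lip_less_iff:
  assumes x: "x \<in> mspace X" and fx: "f x \<in> mspace Y" and c: "0 < c"
  shows "big_Lip X Y f x < ennreal c \<longleftrightarrow>
    (\<exists>r\<in>\<rat> \<inter> {0<..}. \<exists>q\<in>\<rat> \<inter> {0..<c}. x \<in> lipschitz_points X Y f r q)"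
proof -
  let ?D = "\<lambda>r. {u \<in> mspace X. 0 < mdist X u x \<and> mdist X u x < r}"
  let ?g = "\<lambda>u. mdist Y (f u) (f x) / mdist X u x"
  show ?thesis
  proof
    assume "big_Lip X Y f x < ennreal c"
    then obtain s where "0 < s" and s: "(SUP u\<in>?D s. ennreal (?g u)) < ennreal c"
      by (auto simp: big_Lip_def INF_less_iff)
    \<comment> \<open>A supremum below \<open>ennreal c\<close> is finite, so the density of the
      rationals in the reals applies to it. Since \<open>0 \<le> S\<close>, any \<open>q\<close>
      above \<open>S\<close> is nonnegative.\<close>
    obtain S where S: "(SUP u\<in>?D s. ennreal (?g u)) = ennreal S" "0 \<le> S"
      using s by (cases "SUP u\<in>?D s. ennreal (?g u)") auto
    have "S < c"
      using s S by (simp add: ennreal_less_iff)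
    obtain q where q: "q \<in> \<rat>" "S < q" "q < c"
      using Rats_dense_in_real[OF \<open>S < c\<close>] by blast
    obtain r where r: "r \<in> \<rat>" "0 < r" "r < s"
      using Rats_dense_in_real[OF \<open>0 < s\<close>] by blast
    have "mdist Y (f u) (f x) \<le> q * mdist X u x" if u: "u \<in> mspace X" "mdist X u x < r" for u
    proof (cases "u = x")
      case False
      then have pos: "0 < mdist X u x"
        using u x by (metis mdist_nonneg mdist_zero order_le_less)
      have "ennreal (?g u) \<le> ennreal S"
        unfolding S(1)[symmetric] by (rule SUP_upper) (use u pos r in auto)
      then have "?g u \<le> q"
        using S q by (simp add: ennreal_le_iff)
      then show ?thesis
        using pos by (simp add: divide_le_eq)
    next
      \<comment> \<open>The supremum says nothing about the centre, but there both sides of the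
        inequality vanish.\<close>
      case True
      have "mdist X x x = 0" "mdist Y (f x) (f x) = 0"
        using x fx by simp_all
      with True show ?thesis
        by simp
    qed
    then show "\<exists>r\<in>\<rat> \<inter> {0<..}. \<exists>q\<in>\<rat> \<inter> {0..<c}. x \<in> lipschitz_points X Y f r q"
      using q r S x by (intro bexI[of _ r] bexI[of _ q]) (auto simp: lipschitz_points_def)
  next
    assume "\<exists>r\<in>\<rat> \<inter> {0<..}. \<exists>q\<in>\<rat> \<inter> {0..<c}. x \<in> lipschitz_points X Y f r q"
    then obtain r q where r: "0 < r" and q: "0 \<le> q" "q < c"
      and L: "x \<in> lipschitz_points X Y f r q"
      by auto
    \<comment> \<open>Passing to the supremum keeps only a weak inequality; strictness comes back
      from \<open>q < c\<close>. At an isolated point the supremum may be empty, with value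
      0.\<close>
    have "(SUP u\<in>?D r. ennreal (?g u)) \<le> ennreal q"
      using L by (auto intro!: SUP_least ennreal_leI simp: lipschitz_points_def divide_le_eq)
    also have "\<dots> < ennreal c"
      using q by (simp add: ennreal_less_iff)
    finally show "big_Lip X Y f x < ennreal c"
      using r by (auto simp: big_Lip_def INF_less_iff)
  qed
qed

theorem theorem5p4:
  fixes X :: "'a metric" and Y :: "'b metric" and f :: "'a \<Rightarrow> 'b"
  assumes "continuous_map (mtopology_of X) (mtopology_of Y) f"
  shows "fsigma_upper_semicontinuous (mtopology_of X) (\<lambda>x. enn2ereal (big_Lip X Y f x))"
  unfolding fsigma_upper_semicontinuous_def
proof
  fix c :: real
  let ?L = "{x \<in> topspace (mtopology_of X). enn2ereal (big_Lip X Y f x) < ereal c}"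
  show "fsigma_in (mtopology_of X) ?L"
  \<comment> \<open>For positive \<open>c\<close> the comparison with \<open>ereal c\<close> is one
    with \<open>ennreal c\<close>; otherwise the sublevel set is empty, as the derivative is
    nonnegative.\<close>
  proof (cases "0 < c")
    case True
    have "x \<in> ?L \<longleftrightarrow> (\<exists>r\<in>\<rat> \<inter> {0<..}. \<exists>q\<in>\<rat> \<inter> {0..<c}. x \<in> lipschitz_points X Y f r q)" for x
    proof (cases "x \<in> mspace X")
      case x: True
      have "f x \<in> mspace Y"
        using continuous_map_image_subset_topspace[OF assms] x by auto
      then have "big_Lip X Y f x < ennreal c \<longleftrightarrow>
          (\<exists>r\<in>\<rat> \<inter> {0<..}. \<exists>q\<in>\<rat> \<inter> {0..<c}. x \<in> lipschitz_points X Y f r q)"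
        using x True by (intro big_Lip_less_iff)
      moreover have "x \<in> ?L \<longleftrightarrow> big_Lip X Y f x < ennreal c"
        using x True by (simp add: less_ennreal.rep_eq)
      ultimately show ?thesis
        by (simp only:)
    qed (simp add: lipschitz_points_def)
    then have "?L = (\<Union>(r, q) \<in> (\<rat> \<inter> {0<..}) \<times> (\<rat> \<inter> {0..<c}). lipschitz_points X Y f r q)"
      by (intro set_eqI) (simp only: UN_iff split_paired_Bex_Sigma prod.case)
    moreover have "fsigma_in (mtopology_of X)
        (\<Union>(r, q) \<in> (\<rat> \<inter> {0<..}) \<times> (\<rat> \<inter> {0..<c}). lipschitz_points X Y f r q)"
    proof (rule fsigma_in_Union)
      show "countable ((\<lambda>(r, q). lipschitz_points X Y f r q) `
          ((\<rat> \<inter> {0<..}) \<times> (\<rat> \<inter> {0..<c})))"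
        by (intro countable_image countable_SIGMA countable_Int1 countable_rat)
    qed (auto intro!: closed_imp_fsigma_in closedin_lipschitz_points[OF assms])
    ultimately show ?thesis
      by (simp only:)
  next
    case False
    then have "ereal c \<le> enn2ereal b" for b
      by (intro order_trans[OF _ enn2ereal_nonneg]) simp
    then have "?L = {}"
      by (auto dest: leD)
    then show ?thesis
      by (simp only: fsigma_in_empty)
  qed
qed

end
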